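(* Let $\mathbb{X}$ be a Banach space and let $A, B:\mathbb{R}\to L(\mathbb{X})$ be continuous functions such that $\|A(t)\|\le M$ and $\|B(t)\|\le M$ for every $t\in\mathbb{R}$. Consider the equations $$\text{(i)}\ \ \dot x=A(t)x,\qquad \text{(ii)}\ \ \dot y=A(t)y+B(t)y .$$ Let $T(t,s)$ be the evolution operator of (i) and $S(t,s)$ the evolution operator of (ii). Suppose that $\|T(t,s)\|\le Ke^{\alpha(t-s)}$ for all $t\ge s$, $t,s\in\mathbb{R}$, where $\alpha\in\mathbb{R}$ and $K\ge 1$. Let $\delta,h$ be two positive numbers. If $$\Big\|\int_{t_1}^{t_2}B(t)\,dt\Big\|\le\delta\quad\text{for all } t_1,t_2\in\mathbb{R}\text{ with }|t_2-t_1|\le h,$$ then $$\|S(t,s)\|\le(1+\delta)K e^{\beta(t-s)}\quad\text{for } t\ge s,\ t,s\in\mathbb{R},\qquad\text{where } \beta=\alpha+3MK\delta+\frac{\log((1+\delta)K)}{h}.$$ If $\alpha$ is negative, and $h$ is sufficiently large and $\delta$ sufficiently small in such a way that $\beta<0$, then system (ii) is asymptotically stable.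
   Context: $L(\mathbb{X})$ is the Banach space of bounded linear operators on $\mathbb{X}$ with the operator norm, and continuity of $A,B$ is with respect to this norm. The evolution operator of a linear equation $\dot x=A(t)x$ is $T(t,s)=X(t)X^{-1}(s)$, where $X(t)\in L(\mathbb{X})$ is the operator solution of the equation with $X(0)=I$; similarly $S(t,s)=Y(t)Y^{-1}(s)$ with $\dot Y=(A(t)+B(t))Y$, $Y(0)=I$. *)

theory Defs
  imports "HOL-Analysis.Analysis"
begin

definition blinfun_inverse ::
    "('a::real_normed_vector \<Rightarrow>\<^sub>L 'a) \<Rightarrow> ('a \<Rightarrow>\<^sub>L 'a)" where
  "blinfun_inverse f = (THE g. f o\<^sub>L g = id_blinfun \<and> g o\<^sub>L f = id_blinfun)"

text \<open>The derivative is taken in the operator norm. For continuous coefficients on a Banach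
  space the operator solution exists on the whole line, is unique, and has invertible values, so
  the definite descriptions below denote the intended objects.\<close>

definition operator_solution ::
    "(real \<Rightarrow> ('a::banach \<Rightarrow>\<^sub>L 'a)) \<Rightarrow> real \<Rightarrow> ('a \<Rightarrow>\<^sub>L 'a)" where
  "operator_solution A =
    (THE X. X 0 = id_blinfun \<and>
       (\<forall>t. (X has_vector_derivative (A t o\<^sub>L X t)) (at t)))"

definition evolution_operator ::
    "(real \<Rightarrow> ('a::banach \<Rightarrow>\<^sub>L 'a)) \<Rightarrow> real \<Rightarrow> real \<Rightarrow> ('a \<Rightarrow>\<^sub>L 'a)" where
  "evolution_operator A t s =
    operator_solution A t o\<^sub>L blinfun_inverse (operator_solution A s)"

text \<open>\<^term>\<open>integral {a..b} f\<close> is \<^term>\<open>0\<close> for \<^prop>\<open>b < a\<close>, and the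
  interval integral of \<^theory>\<open>HOL-Analysis.Interval_Integral\<close> requires a second-countable
  codomain, which spaces of operators need not be.\<close>

definition oriented_integral :: "real \<Rightarrow> real \<Rightarrow> (real \<Rightarrow> 'b::banach) \<Rightarrow> 'b" where
  "oriented_integral a b f =
    (if a \<le> b then integral {a..b} f else - integral {b..a} f)"

definition solution_from :: "(real \<Rightarrow> 'a::banach \<Rightarrow> 'a) \<Rightarrow> real \<Rightarrow> (real \<Rightarrow> 'a) \<Rightarrow> bool" where
  "solution_from f t0 y \<longleftrightarrow>
    (\<forall>t\<ge>t0. (y has_vector_derivative f t (y t)) (at t within {t0..}))"

text \<open>Asymptotic stability in the sense of Lyapunov of the zero solution of \<open>y' = f t y\<close>.
  Only solutions defined on all of \<open>[t0, \<infinity>)\<close> are considered; for linear equations with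
  continuous coefficients every solution extends to such a one.\<close>

definition asymptotically_stable :: "(real \<Rightarrow> 'a::banach \<Rightarrow> 'a) \<Rightarrow> bool" where
  "asymptotically_stable f \<longleftrightarrow>
    (\<forall>t0.
      (\<forall>\<epsilon>>0. \<exists>\<eta>>0. \<forall>y. solution_from f t0 y \<longrightarrow> norm (y t0) < \<eta> \<longrightarrow>
         (\<forall>t\<ge>t0. norm (y t) < \<epsilon>)) \<and>
      (\<exists>\<eta>>0. \<forall>y. solution_from f t0 y \<longrightarrow> norm (y t0) < \<eta> \<longrightarrow>
         (y \<longlongrightarrow> 0) at_top))"

end

theory Submission imports Defs begin

text \<open>Fix \<open>\<tau>\<close> and put \<open>E u = - \<integral>\<^bsub>u\<^esub>\<^bsup>\<tau>\<^esup> B\<close>, so that \<open>E' = B\<close>, \<open>E \<tau> = 0\<close> and \<open>E\<close> is bounded by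
  \<open>\<delta>\<close> at distance at most \<open>h\<close> from \<open>\<tau>\<close>. The derivative of \<open>T(\<tau>,u) (1 - E u) S(u,s)\<close> in \<open>u\<close> is
  \<open>T(\<tau>,u) (A E - E A - E B) S(u,s)\<close>, which is bounded by
  \<open>3 M K \<delta> exp (\<alpha> (\<tau> - u)) \<parallel>S(u,s)\<parallel>\<close>. Integrating over \<open>[s, \<tau>]\<close> and applying Gronwall's
  inequality gives \<open>\<parallel>S(t,s)\<parallel> \<le> D exp ((\<alpha> + 3 M K \<delta>) (t - s))\<close> with \<open>D = (1 + \<delta>) K\<close> for
  \<open>0 \<le> t - s \<le> h\<close>. The cocycle property multiplies these bounds over consecutive intervals of
  length \<open>h\<close>, which costs a factor \<open>D\<close> per interval and hence the summand \<open>ln D / h\<close> of \<open>\<beta>\<close>.\<close>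

subsection \<open>Primitives and Gronwall's inequality\<close>

lemma has_vector_derivative_UNIV_continuous_on:
  "(\<And>t. (f has_vector_derivative f' t) (at t)) \<Longrightarrow> continuous_on S f"
  by (meson continuous_at_imp_continuous_on has_vector_derivative_continuous)

text \<open>Near \<open>t\<close> the oriented integral differs by a constant from
  \<open>integral {-R..u} f\<close>, for which \<open>t\<close> is an interior point, so the
  derivative within an interval is two-sided.\<close>

lemma oriented_integral_has_vector_derivative:
  fixes f :: "real \<Rightarrow> 'a::banach"
  assumes "continuous_on UNIV f"
  shows "((\<lambda>t. oriented_integral 0 t f) has_vector_derivative f t) (at t)"
proof -
  define R where "R = \<bar>t\<bar> + 1"
  have int: "f integrable_on {a..b}" for a b
    by (meson assms continuous_on_subset integrable_continuous_real subset_UNIV)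
  have "((\<lambda>u. integral {-R..u} f) has_vector_derivative f t) (at t within {-R..R})"
    by (rule integral_has_vector_derivative)
      (auto simp: R_def intro: continuous_on_subset[OF assms])
  then have "((\<lambda>u. integral {-R..u} f) has_vector_derivative f t) (at t)"
    by (subst (asm) at_within_interior) (auto simp: R_def)
  then have "((\<lambda>u. integral {-R..u} f - integral {-R..0} f) has_vector_derivative f t) (at t)"
    by (auto intro!: derivative_eq_intros)
  then show ?thesis
  proof (rule has_vector_derivative_transform_within_open)
    show "open {-R<..<R}" "t \<in> {-R<..<R}"
      by (auto simp: R_def)
    show "integral {-R..u} f - integral {-R..0} f = oriented_integral 0 u f"
      if "u \<in> {-R<..<R}" for u
    proof (cases "0 \<le> u")
      case True
      with that have "integral {-R..0} f + integral {0..u} f = integral {-R..u} f"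
        by (intro Henstock_Kurzweil_Integration.integral_combine int) auto
      then show ?thesis
        using True by (simp add: oriented_integral_def algebra_simps)
    next
      case False
      with that have "integral {-R..u} f + integral {u..0} f = integral {-R..0} f"
        by (intro Henstock_Kurzweil_Integration.integral_combine int) auto
      then show ?thesis
        using False by (simp add: oriented_integral_def algebra_simps)
    qed
  qed
qed

lemma oriented_integral_eq_diff:
  fixes F :: "real \<Rightarrow> 'a::banach"
  assumes "\<And>t. (F has_vector_derivative f t) (at t)"
  shows "oriented_integral a b f = F b - F a"
  using fundamental_theorem_of_calculus[of a b F f] fundamental_theorem_of_calculus[of b a F f] assms
  by (auto simp: oriented_integral_def has_vector_derivative_at_within dest!: integral_unique)

text \<open>Integrating factor: with \<open>G\<close> the integral of \<open>f\<close>, the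
  hypothesis makes the derivative of \<open>(c + k * G t) * exp (- k * (t - a))\<close> nonpositive,
  and \<open>G a = 0\<close>.\<close>

lemma gronwall:
  fixes f :: "real \<Rightarrow> real"
  assumes cont: "continuous_on {a..b} f" and "a \<le> b" and "k \<ge> 0"
    and le: "\<And>t. a \<le> t \<Longrightarrow> t \<le> b \<Longrightarrow> f t \<le> c + k * integral {a..t} f"
  shows "f b \<le> c * exp (k * (b - a))"
proof -
  define G where "G = (\<lambda>t. integral {a..t} f)"
  define H where "H = (\<lambda>t. (c + k * G t) * exp (- k * (t - a)))"
  have G': "(G has_real_derivative f t) (at t within {a..b})" if "t \<in> {a..b}" for t
    unfolding G_def has_real_derivative_iff_has_vector_derivative
    by (rule integral_has_vector_derivative[OF cont that])
  have H': "(H has_real_derivative k * (f t - (c + k * G t)) * exp (- k * (t - a)))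
      (at t within {a..b})" if "t \<in> {a..b}" for t
    unfolding H_def
    by (rule derivative_eq_intros G' that refl | simp add: algebra_simps)+
  have "continuous_on {a..b} (\<lambda>t. - H t)"
    by (intro continuous_on_minus DERIV_continuous_on[OF H'])
  moreover have "\<exists>y. ((\<lambda>t. - H t) has_real_derivative y) (at t) \<and> y \<ge> 0"
    if "a < t" "t < b" for t
  proof (intro exI conjI)
    have "(H has_real_derivative k * (f t - (c + k * G t)) * exp (- k * (t - a))) (at t)"
      using H'[of t] that by (simp add: at_within_Icc_at)
    then show "((\<lambda>t. - H t) has_real_derivative
        - (k * (f t - (c + k * G t)) * exp (- k * (t - a)))) (at t)"
      by (rule DERIV_minus)
    show "0 \<le> - (k * (f t - (c + k * G t)) * exp (- k * (t - a)))"
      using le[of t] that \<open>k \<ge> 0\<close>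
      by (simp add: G_def mult_nonneg_nonpos mult_nonpos_nonneg)
  qed
  ultimately have "- H a \<le> - H b"
    by (intro DERIV_nonneg_imp_increasing_open[OF \<open>a \<le> b\<close>, of "\<lambda>t. - H t"])
  then have "(c + k * G b) * exp (- k * (b - a)) \<le> c"
    by (simp add: H_def G_def)
  then have "c + k * G b \<le> c * exp (k * (b - a))"
    by (simp add: exp_minus pos_divide_le_eq flip: divide_inverse)
  with le[of b] \<open>a \<le> b\<close> show ?thesis
    by (simp add: G_def)
qed

text \<open>Continuity is asked of the majorant \<open>g\<close> only; integrability of
  \<open>f'\<close> comes from the fundamental theorem of calculus.\<close>

lemma norm_le_integral_of_derivative:
  fixes f :: "real \<Rightarrow> 'a::banach"
  assumes "a \<le> b"
    and f': "\<And>t. (f has_vector_derivative f' t) (at t)"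
    and g: "continuous_on {a..b} g"
    and le: "\<And>t. a \<le> t \<Longrightarrow> t \<le> b \<Longrightarrow> norm (f' t) \<le> g t"
  shows "norm (f b - f a) \<le> integral {a..b} g"
proof -
  have "(f' has_integral f b - f a) {a..b}"
    using assms by (intro fundamental_theorem_of_calculus) (auto intro: has_vector_derivative_at_within)
  then show ?thesis
    using integral_norm_bound_integral[of f' "{a..b}" g] integrable_continuous_real[OF g] le
    by (auto simp: has_integral_iff)
qed

lemma has_vector_derivative_reflect:
  assumes "\<And>t. (f has_vector_derivative f' t) (at t)"
  shows "((\<lambda>t. f (- t)) has_vector_derivative - f' (- t)) (at t)"
proof -
  have "(uminus has_vector_derivative - 1) (at t)" for t :: real
    by (auto intro!: derivative_eq_intros)
  from vector_diff_chain_at[OF this assms] show ?thesis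
    by (simp add: o_def)
qed

text \<open>Induction step for the factorial bounds on Picard increments. For positive times
  \<open>f\<close> is compared with the primitive of \<open>c * t ^ n\<close>; negative times follow
  by reflection.\<close>

lemma norm_le_power_of_derivative:
  fixes f :: "real \<Rightarrow> 'a::banach"
  assumes f': "\<And>t. (f has_vector_derivative f' t) (at t)" and "f 0 = 0"
    and le: "\<And>t. norm (f' t) \<le> c * \<bar>t\<bar> ^ n"
  shows "norm (f t) \<le> c * \<bar>t\<bar> ^ Suc n / real (Suc n)"
proof -
  have pos: "norm (g t) \<le> c * t ^ Suc n / real (Suc n)"
    if "t > 0" and g': "\<And>t. (g has_vector_derivative g' t) (at t)" and "g 0 = 0"
      and le: "\<And>t. norm (g' t) \<le> c * \<bar>t\<bar> ^ n" for t g' and g :: "real \<Rightarrow> 'a"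
  proof -
    have phi: "((\<lambda>t. c * t ^ Suc n / real (Suc n)) has_vector_derivative c * x ^ n) (at x)" for x
      unfolding has_real_derivative_iff_has_vector_derivative[symmetric]
      by (rule derivative_eq_intros refl | simp)+
    have "norm (g t - g 0) \<le> c * t ^ Suc n / real (Suc n) - c * 0 ^ Suc n / real (Suc n)"
    proof (rule differentiable_bound_general[OF \<open>t > 0\<close> _ _ g' phi])
      show "norm (g' x) \<le> c * x ^ n" if "0 < x" for x
        using le[of x] that by simp
    qed (use has_vector_derivative_UNIV_continuous_on[OF g'] in \<open>auto intro!: continuous_intros\<close>)
    then show ?thesis
      using \<open>g 0 = 0\<close> by simp
  qed
  consider "t > 0" | "t = 0" | "t < 0" by linarith
  then show ?thesis
  proof cases
    case 1
    then show ?thesis using pos[OF 1 f' \<open>f 0 = 0\<close> le] by simp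
  next
    case 2
    then show ?thesis using \<open>f 0 = 0\<close> by simp
  next
    case 3
    then have "norm (f (- (- t))) \<le> c * (- t) ^ Suc n / real (Suc n)"
      using le[of "- _"] \<open>f 0 = 0\<close>
      by (intro pos[OF _ has_vector_derivative_reflect[OF f']]) auto
    then show ?thesis using 3 by simp
  qed
qed

subsection \<open>Linear differential equations with bounded coefficients\<close>

text \<open>\<open>L\<close> is kept abstract because the unknown will itself be an operator,
  multiplied from both sides. Continuity along continuous curves is what keeps the Picard integrands
  continuous.\<close>

locale bounded_linear_ode =
  fixes L :: "real \<Rightarrow> 'a::banach \<Rightarrow> 'a" and M :: real
  assumes bounded_linear: "bounded_linear (L t)"
    and norm_le: "norm (L t x) \<le> M * norm x"
    and continuous: "continuous_on UNIV y \<Longrightarrow> continuous_on UNIV (\<lambda>t. L t (y t))"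
begin

text \<open>On the zero space \<open>M\<close> may be negative, while Gronwall's inequality and the
  Picard bounds use a nonnegative constant.\<close>

lemma norm_le_max: "norm (L t x) \<le> max M 0 * norm x"
  using norm_le[of t x] mult_right_mono[of M "max M 0" "norm x"] by simp

lemma solution_zero_forward:
  assumes x': "\<And>t. (x has_vector_derivative L t (x t)) (at t)" and "x 0 = 0" and "t \<ge> 0"
  shows "x t = 0"
proof -
  define k where "k = max M 0"
  have x_cont: "continuous_on S x" for S
    using x' by (rule has_vector_derivative_UNIV_continuous_on)
  then have cont: "continuous_on S (\<lambda>t. norm (x t))" for S
    by (rule continuous_on_norm)
  have "norm (x t) \<le> 0 * exp (k * (t - 0))"
  proof (rule gronwall[OF cont \<open>t \<ge> 0\<close>])
    show "k \<ge> 0" by (simp add: k_def)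
    fix u :: real assume "0 \<le> u"
    have "norm (x u - x 0) \<le> integral {0..u} (\<lambda>s. k * norm (x s))"
      using norm_le_max k_def x_cont
      by (intro norm_le_integral_of_derivative[OF \<open>0 \<le> u\<close> x'])
        (auto intro!: continuous_intros)
    then show "norm (x u) \<le> 0 + k * integral {0..u} (\<lambda>s. norm (x s))"
      using \<open>x 0 = 0\<close> by simp
  qed
  then show ?thesis by simp
qed

lemma reflect: "bounded_linear_ode (\<lambda>t x. - L (- t) x) M"
proof (rule bounded_linear_ode.intro)
  show "bounded_linear (\<lambda>x. - L (- t) x)" for t
    using bounded_linear by (rule bounded_linear_minus)
  show "norm (- L (- t) x) \<le> M * norm x" for t x
    using norm_le by simp
  fix x :: "real \<Rightarrow> 'a" assume x: "continuous_on UNIV x"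
  have "continuous_on UNIV (\<lambda>t. x (- t))"
    by (rule continuous_on_compose2[OF x]) (auto intro: continuous_intros)
  from continuous[OF this] have "continuous_on UNIV (\<lambda>t. L (- t) (x (- (- t))))"
    by (rule continuous_on_compose2) (auto intro: continuous_intros)
  then show "continuous_on UNIV (\<lambda>t. - L (- t) (x t))"
    by (auto intro: continuous_intros)
qed

text \<open>The difference solves the same equation and vanishes at 0. Gronwall's inequality kills
  it for positive times, and for negative times after time reversal.\<close>

lemma solution_unique:
  assumes x: "\<And>t. (x has_vector_derivative L t (x t)) (at t)"
    and y: "\<And>t. (y has_vector_derivative L t (y t)) (at t)"
    and "x 0 = y 0"
  shows "x = y"
proof
  fix t
  define z where "z = (\<lambda>t. x t - y t)"
  have z': "(z has_vector_derivative L t (z t)) (at t)" for t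
    unfolding z_def using has_vector_derivative_diff[OF x y]
    by (simp add: bounded_linear.linear[OF bounded_linear] linear_diff)
  have "z 0 = 0" using assms(3) by (simp add: z_def)
  interpret R: bounded_linear_ode "\<lambda>t x. - L (- t) x" M
    by (rule reflect)
  have "z t = 0"
    using solution_zero_forward[OF z' \<open>z 0 = 0\<close>, of t]
      R.solution_zero_forward[OF has_vector_derivative_reflect[OF z'], of "- t"] \<open>z 0 = 0\<close>
    by (cases "t \<ge> 0") auto
  then show "x t = y t" by (simp add: z_def)
qed

text \<open>The solution is the sum of the Picard increments \<open>P n\<close>, each the integral
  of \<open>L\<close> along the previous one. Their factorial bounds make the series of derivatives
  converge locally uniformly, so it may be differentiated termwise.\<close>

lemma solution_exists:
  obtains x where "x 0 = x0" and "\<And>t. (x has_vector_derivative L t (x t)) (at t)"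
proof -
  define k where "k = max M 0"
  have k: "norm (L t x) \<le> k * norm x" "k \<ge> 0" for t x
    using norm_le_max by (auto simp: k_def)
  define P where "P = rec_nat (\<lambda>_. x0) (\<lambda>n p t. oriented_integral 0 t (\<lambda>s. L s (p s)))"
  \<comment> \<open>\<open>D n\<close> is the derivative of \<open>P n\<close>. Since
    \<open>P 0\<close> is constant, the index shift turns the sum of the \<open>D n\<close> into
    \<open>L t\<close> of the sum of the \<open>P n\<close>.\<close>
  define D where "D = (\<lambda>n t. case n of 0 \<Rightarrow> 0 | Suc m \<Rightarrow> L t (P m t))"
  have P_0 [simp]: "P 0 = (\<lambda>_. x0)" by (simp add: P_def)
  have P_Suc: "P (Suc n) = (\<lambda>t. oriented_integral 0 t (\<lambda>s. L s (P n s)))" for n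
    by (simp add: P_def)
  have P_Suc_0 [simp]: "P (Suc n) 0 = 0" for n
    by (simp add: P_Suc oriented_integral_def)
  have P_D: "(P n has_vector_derivative D n t) (at t)" and P_cont: "continuous_on UNIV (P n)" for n t
  proof (induction n arbitrary: t)
    case (Suc n)
    show "(P (Suc n) has_vector_derivative D (Suc n) t) (at t)" for t
      unfolding P_Suc D_def
      using oriented_integral_has_vector_derivative[OF continuous[OF Suc(2)]] by simp
    then show "continuous_on UNIV (P (Suc n))"
      by (rule has_vector_derivative_UNIV_continuous_on)
  qed (auto simp: D_def)
  have P_le: "norm (P n t) \<le> norm x0 * k ^ n / fact n * \<bar>t\<bar> ^ n" for n t
  proof (induction n arbitrary: t)
    case (Suc n)
    have "norm (P (Suc n) t) \<le> (norm x0 * k ^ Suc n / fact n) * \<bar>t\<bar> ^ Suc n / real (Suc n)"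
    proof (rule norm_le_power_of_derivative[OF P_D])
      show "norm (D (Suc n) t) \<le> norm x0 * k ^ Suc n / fact n * \<bar>t\<bar> ^ n" for t
        using order.trans[OF k(1) mult_left_mono[OF Suc k(2)]]
        by (simp add: D_def algebra_simps)
    qed simp
    then show ?case by (simp add: field_simps)
  qed simp
  have exp_sum: "summable (\<lambda>n. norm x0 * k ^ n / fact n * R ^ n)" for R
    using summable_mult[OF summable_exp[of "k * R"], of "norm x0"]
    by (simp add: field_simps)
  have P_summable: "summable (\<lambda>n. P n t)" for t
    by (rule summable_comparison_test'[OF exp_sum[of "\<bar>t\<bar>"] P_le])
  define x where "x = (\<lambda>t. \<Sum>n. P n t)"
  have P_sums: "(\<lambda>n. P n t) sums x t" for t
    unfolding x_def using P_summable by (rule summable_sums)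
  have D_sums: "(\<lambda>n. D n t) sums L t (x t)" for t
    using sums_Suc[of "\<lambda>n. D n t"] bounded_linear.sums[OF bounded_linear P_sums, of t t]
    by (simp add: D_def)
  have x': "(x has_vector_derivative L t (x t)) (at t)" for t
  proof -
    define R where "R = \<bar>t\<bar> + 1"
    define S where "S = {-R<..<R}"
    have S: "open S" "convex S" "t \<in> S"
      by (auto simp: S_def R_def)
    \<comment> \<open>Weierstrass majorant for \<open>D n\<close> on all of \<open>S\<close>: the
      bound on \<open>P m\<close> with \<open>\<bar>u\<bar>\<close> replaced by
      \<open>R\<close>.\<close>
    define b where "b = (\<lambda>n. case n of 0 \<Rightarrow> 0 | Suc m \<Rightarrow> k * (norm x0 * k ^ m / fact m * R ^ m))"
    have "summable (\<lambda>n. b (Suc n))"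
      unfolding b_def nat.case by (intro summable_mult exp_sum)
    then have "summable b"
      by (simp only: summable_Suc_iff)
    moreover have "norm (D n u) \<le> b n" if "u \<in> S" for n u
    proof (cases n)
      case (Suc m)
      have "norm (P m u) \<le> norm x0 * k ^ m / fact m * R ^ m"
        by (rule order.trans[OF P_le], rule mult_left_mono, rule power_mono)
          (use that k(2) in \<open>auto simp: S_def\<close>)
      then have "norm (L u (P m u)) \<le> k * (norm x0 * k ^ m / fact m * R ^ m)"
        by (rule order.trans[OF k(1) mult_left_mono[OF _ k(2)]])
      then show ?thesis
        by (simp only: Suc D_def b_def nat.case)
    qed (simp add: D_def b_def)
    ultimately have "uniform_limit S (\<lambda>n u. \<Sum>i<n. D i u) (\<lambda>u. \<Sum>i. D i u) sequentially"
      by (intro Weierstrass_m_test) auto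
    then have lim: "uniform_limit S (\<lambda>n u. \<Sum>i<n. D i u) (\<lambda>u. L u (x u)) sequentially"
      by (simp add: sums_unique[OF D_sums, symmetric])
    \<comment> \<open>Termwise differentiation yields some limit \<open>g\<close>; uniqueness of
      sums identifies it with \<open>x\<close> on \<open>S\<close>.\<close>
    have "\<exists>g. \<forall>u\<in>S. (\<lambda>n. P n u) sums g u \<and>
        (g has_derivative (\<lambda>h. h *\<^sub>R L u (x u))) (at u within S)"
    proof (rule has_derivative_series[OF \<open>convex S\<close> _ _ \<open>t \<in> S\<close> P_sums])
      show "(P n has_derivative (\<lambda>h. h *\<^sub>R D n u)) (at u within S)" for n u
        using P_D has_vector_derivative_at_within unfolding has_vector_derivative_def by blast
      fix e :: real assume "e > 0"
      show "\<forall>\<^sub>F n in sequentially. \<forall>u\<in>S. \<forall>h.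
          norm ((\<Sum>i<n. h *\<^sub>R D i u) - h *\<^sub>R L u (x u)) \<le> e * norm h"
        using uniform_limitD[OF lim \<open>e > 0\<close>]
      proof (eventually_elim, intro ballI allI)
        fix n u h assume "\<forall>u\<in>S. dist (\<Sum>i<n. D i u) (L u (x u)) < e" "u \<in> S"
        then have "norm ((\<Sum>i<n. D i u) - L u (x u)) \<le> e"
          by (auto simp: dist_norm less_imp_le)
        then have "norm (h *\<^sub>R ((\<Sum>i<n. D i u) - L u (x u))) \<le> e * norm h"
          by (simp add: mult.commute[of e] mult_left_mono)
        then show "norm ((\<Sum>i<n. h *\<^sub>R D i u) - h *\<^sub>R L u (x u)) \<le> e * norm h"
          by (simp add: scaleR_sum_right scaleR_diff_right)
      qed
    qed
    then obtain g where g: "\<And>u. u \<in> S \<Longrightarrow> (\<lambda>n. P n u) sums g u"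
      "\<And>u. u \<in> S \<Longrightarrow> (g has_vector_derivative L u (x u)) (at u within S)"
      by (auto simp: has_vector_derivative_def)
    have "(g has_vector_derivative L t (x t)) (at t)"
      using g(2)[OF \<open>t \<in> S\<close>] at_within_open[OF \<open>t \<in> S\<close> \<open>open S\<close>] by simp
    then show ?thesis
      using S g(1) P_sums sums_unique2
      by (intro has_vector_derivative_transform_within_open[of g _ t S x]) blast+
  qed
  \<comment> \<open>All increments except \<open>P 0\<close> vanish at 0.\<close>
  have "(\<lambda>n. P n 0) sums x0"
    using sums_Suc[of "\<lambda>n. P n 0" 0] by simp
  with P_sums have "x 0 = x0"
    by (rule sums_unique2)
  then show thesis
    using x' by (rule that)
qed

end

subsection \<open>Evolution operators\<close>

lemma has_vector_derivative_blinfun_compose: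
  assumes "(f has_vector_derivative f') (at t within S)"
    and "(g has_vector_derivative g') (at t within S)"
  shows "((\<lambda>t. f t o\<^sub>L g t) has_vector_derivative ((f t o\<^sub>L g') + (f' o\<^sub>L g t))) (at t within S)"
  using bounded_bilinear.has_vector_derivative[OF bounded_bilinear_blinfun_compose assms] .

lemma blinfun_compose_assoc: "(f o\<^sub>L g) o\<^sub>L h = f o\<^sub>L (g o\<^sub>L h)"
  by (rule blinfun_eqI) simp

lemma blinfun_compose_id [simp]: "f o\<^sub>L id_blinfun = f" "id_blinfun o\<^sub>L f = f"
  by (rule blinfun_eqI, simp)+

lemmas blinfun_compose_algebra =
  bounded_bilinear.add_left[OF bounded_bilinear_blinfun_compose]
  bounded_bilinear.add_right[OF bounded_bilinear_blinfun_compose]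
  bounded_bilinear.diff_left[OF bounded_bilinear_blinfun_compose]
  bounded_bilinear.diff_right[OF bounded_bilinear_blinfun_compose]
  bounded_bilinear.minus_left[OF bounded_bilinear_blinfun_compose]
  bounded_bilinear.minus_right[OF bounded_bilinear_blinfun_compose]
  bounded_bilinear.zero_left[OF bounded_bilinear_blinfun_compose]
  bounded_bilinear.zero_right[OF bounded_bilinear_blinfun_compose]
  blinfun_compose_assoc

lemma blinfun_inverse_eq:
  assumes "f o\<^sub>L g = id_blinfun" "g o\<^sub>L f = id_blinfun"
  shows "blinfun_inverse f = g"
  unfolding blinfun_inverse_def
proof (rule the_equality)
  fix k assume k: "f o\<^sub>L k = id_blinfun \<and> k o\<^sub>L f = id_blinfun"
  have "k = (g o\<^sub>L f) o\<^sub>L k"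
    by (simp add: assms)
  also have "\<dots> = g"
    using k by (simp add: blinfun_compose_assoc)
  finally show "k = g" .
qed (use assms in simp)

text \<open>Both \<open>X' = A X\<close> and the equation \<open>Z' = - Z A\<close> of its inverse are instances, and
  \<open>C = A\<close> is used to identify \<open>X Z\<close> with the constant solution.\<close>

lemma bounded_linear_ode_sylvester:
  fixes A C :: "real \<Rightarrow> 'a::banach \<Rightarrow>\<^sub>L 'a"
  assumes "continuous_on UNIV A" "continuous_on UNIV C"
    and A: "\<And>t. norm (A t) \<le> M" and C: "\<And>t. norm (C t) \<le> N"
  shows "bounded_linear_ode (\<lambda>t W. (A t o\<^sub>L W) - (W o\<^sub>L C t)) (M + N)"
proof (rule bounded_linear_ode.intro)
  show "bounded_linear (\<lambda>W. (A t o\<^sub>L W) - (W o\<^sub>L C t))" for t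
    by (intro bounded_linear_sub bounded_bilinear.bounded_linear_left
        bounded_bilinear.bounded_linear_right bounded_bilinear_blinfun_compose)
  show "norm ((A t o\<^sub>L W) - (W o\<^sub>L C t)) \<le> (M + N) * norm W" for t and W :: "'a \<Rightarrow>\<^sub>L 'a"
  proof -
    have "norm ((A t o\<^sub>L W) - (W o\<^sub>L C t)) \<le> norm (A t) * norm W + norm W * norm (C t)"
      by (intro order.trans[OF norm_triangle_ineq4] add_mono norm_blinfun_compose)
    also have "\<dots> \<le> M * norm W + norm W * N"
      by (intro add_mono mult_right_mono mult_left_mono A C) auto
    finally show ?thesis
      by (simp add: algebra_simps)
  qed
  show "continuous_on UNIV (\<lambda>t. (A t o\<^sub>L W t) - (W t o\<^sub>L C t))"
    if "continuous_on UNIV W" for W :: "real \<Rightarrow> 'a \<Rightarrow>\<^sub>L 'a"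
    using assms that
    by (intro continuous_on_diff bounded_bilinear.continuous_on[OF bounded_bilinear_blinfun_compose])
qed

section \<open>The operator solution, its inverse and the cocycle property\<close>

locale bounded_operator_ode =
  fixes A :: "real \<Rightarrow> 'a::banach \<Rightarrow>\<^sub>L 'a" and M :: real
  assumes A_cont: "continuous_on UNIV A" and A_le: "norm (A t) \<le> M"
begin

lemma M_nonneg: "0 \<le> M"
  using order.trans[OF norm_ge_zero A_le] .

text \<open>The inverse is obtained from its own differential equation, and uniqueness then gives
  both inverse identities. The last clause is what determines the definite description in
  \<open>operator_solution\<close>.\<close>

lemma solution_with_inverse:
  obtains X Z where
    "X 0 = id_blinfun" and "\<And>t. (X has_vector_derivative A t o\<^sub>L X t) (at t)"
    and "\<And>t. (Z has_vector_derivative - (Z t o\<^sub>L A t)) (at t)"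
    and "\<And>t. X t o\<^sub>L Z t = id_blinfun" and "\<And>t. Z t o\<^sub>L X t = id_blinfun"
    and "\<And>Y. Y 0 = id_blinfun \<Longrightarrow> (\<And>t. (Y has_vector_derivative A t o\<^sub>L Y t) (at t)) \<Longrightarrow> Y = X"
proof -
  have zero: "continuous_on UNIV (\<lambda>t::real. 0 :: 'a \<Rightarrow>\<^sub>L 'a)" "norm (0 :: 'a \<Rightarrow>\<^sub>L 'a) \<le> 0"
    by simp_all
  interpret X: bounded_linear_ode "\<lambda>t W. (A t o\<^sub>L W) - (W o\<^sub>L (0 :: 'a \<Rightarrow>\<^sub>L 'a))" "M + 0"
    by (rule bounded_linear_ode_sylvester[OF A_cont zero(1) A_le zero(2)])
  interpret Z: bounded_linear_ode "\<lambda>t W. ((0 :: 'a \<Rightarrow>\<^sub>L 'a) o\<^sub>L W) - (W o\<^sub>L A t)" "0 + M"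
    by (rule bounded_linear_ode_sylvester[OF zero(1) A_cont zero(2) A_le])
  interpret W: bounded_linear_ode "\<lambda>t W. (A t o\<^sub>L W) - (W o\<^sub>L A t)" "M + M"
    by (rule bounded_linear_ode_sylvester[OF A_cont A_cont A_le A_le])
  interpret zero: bounded_linear_ode "\<lambda>t W. ((0 :: 'a \<Rightarrow>\<^sub>L 'a) o\<^sub>L W) - (W o\<^sub>L (0 :: 'a \<Rightarrow>\<^sub>L 'a))" "0 + 0"
    by (rule bounded_linear_ode_sylvester[OF zero(1) zero(1) zero(2) zero(2)])
  obtain X where X: "X 0 = id_blinfun" "\<And>t. (X has_vector_derivative A t o\<^sub>L X t) (at t)"
    using X.solution_exists[of id_blinfun] by (auto simp: blinfun_compose_algebra)
  obtain Z where Z: "Z 0 = id_blinfun" "\<And>t. (Z has_vector_derivative - (Z t o\<^sub>L A t)) (at t)"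
    using Z.solution_exists[of id_blinfun] by (auto simp: blinfun_compose_algebra)
  \<comment> \<open>Both sides solve \<open>W' = A W - W A\<close> with the identity as value at
    0.\<close>
  have "(\<lambda>t. X t o\<^sub>L Z t) = (\<lambda>t. id_blinfun)"
  proof (rule W.solution_unique)
    show "((\<lambda>t. X t o\<^sub>L Z t) has_vector_derivative
        (A t o\<^sub>L (X t o\<^sub>L Z t)) - ((X t o\<^sub>L Z t) o\<^sub>L A t)) (at t)" for t
      using has_vector_derivative_blinfun_compose[OF X(2) Z(2)]
      by (simp add: blinfun_compose_algebra)
  qed (auto simp: X(1) Z(1))
  \<comment> \<open>In this order the two terms \<open>Z A X\<close> of the derivative cancel, so
    the equation with zero coefficients applies.\<close>
  moreover have "(\<lambda>t. Z t o\<^sub>L X t) = (\<lambda>t. id_blinfun)"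
  proof (rule zero.solution_unique)
    show "((\<lambda>t. Z t o\<^sub>L X t) has_vector_derivative
        (0 o\<^sub>L (Z t o\<^sub>L X t)) - ((Z t o\<^sub>L X t) o\<^sub>L 0)) (at t)" for t
      using has_vector_derivative_blinfun_compose[OF Z(2) X(2)]
      by (simp add: blinfun_compose_algebra)
  qed (auto simp: X(1) Z(1) blinfun_compose_algebra)
  moreover have "Y = X"
    if "Y 0 = id_blinfun" "\<And>t. (Y has_vector_derivative A t o\<^sub>L Y t) (at t)" for Y
    using X that by (intro X.solution_unique) (auto simp: blinfun_compose_algebra)
  ultimately show thesis
    by (intro that[OF X Z(2)]) (auto dest: fun_cong)
qed

abbreviation "X \<equiv> operator_solution A"
abbreviation "T \<equiv> evolution_operator A"

lemma operator_solution:
  shows solution_0: "X 0 = id_blinfun"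
    and solution_deriv: "(X has_vector_derivative A t o\<^sub>L X t) (at t)"
    and inverse_deriv: "((\<lambda>t. blinfun_inverse (X t)) has_vector_derivative
      - (blinfun_inverse (X t) o\<^sub>L A t)) (at t)"
    and solution_inverse: "X t o\<^sub>L blinfun_inverse (X t) = id_blinfun"
    and inverse_solution: "blinfun_inverse (X t) o\<^sub>L X t = id_blinfun"
proof -
  obtain X' Z where X': "X' 0 = id_blinfun" "\<And>t. (X' has_vector_derivative A t o\<^sub>L X' t) (at t)"
    and Z: "\<And>t. (Z has_vector_derivative - (Z t o\<^sub>L A t)) (at t)"
      "\<And>t. X' t o\<^sub>L Z t = id_blinfun" "\<And>t. Z t o\<^sub>L X' t = id_blinfun"
    and unique: "\<And>Y. Y 0 = id_blinfun \<Longrightarrow>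
      (\<And>t. (Y has_vector_derivative A t o\<^sub>L Y t) (at t)) \<Longrightarrow> Y = X'"
    by (rule solution_with_inverse) (rule that; blast)
  have X: "X = X'"
    unfolding operator_solution_def
  proof (rule the_equality)
    show "Y = X'" if "Y 0 = id_blinfun \<and> (\<forall>t. (Y has_vector_derivative A t o\<^sub>L Y t) (at t))" for Y
      using that by (intro unique) auto
  qed (use X' in simp)
  have inv: "blinfun_inverse (X t) = Z t" for t
    unfolding X using Z(2,3) by (rule blinfun_inverse_eq)
  show "((\<lambda>t. blinfun_inverse (X t)) has_vector_derivative
      - (blinfun_inverse (X t) o\<^sub>L A t)) (at t)"
    unfolding inv by (rule Z(1))
  show "X 0 = id_blinfun" "(X has_vector_derivative A t o\<^sub>L X t) (at t)"
    "X t o\<^sub>L blinfun_inverse (X t) = id_blinfun" "blinfun_inverse (X t) o\<^sub>L X t = id_blinfun"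
    unfolding inv unfolding X by (rule X' Z)+
qed

lemma evolution_refl [simp]: "T s s = id_blinfun"
  by (simp add: evolution_operator_def solution_inverse)

lemma evolution_compose: "T t r o\<^sub>L T r s = T t s"
proof -
  have "T t r o\<^sub>L T r s = X t o\<^sub>L ((blinfun_inverse (X r) o\<^sub>L X r) o\<^sub>L blinfun_inverse (X s))"
    by (simp add: evolution_operator_def blinfun_compose_assoc)
  then show ?thesis
    by (simp add: inverse_solution evolution_operator_def)
qed

lemma evolution_deriv: "((\<lambda>t. T t s) has_vector_derivative A t o\<^sub>L T t s) (at t)"
  unfolding evolution_operator_def
  using has_vector_derivative_blinfun_compose[OF solution_deriv[of t]
      has_vector_derivative_const[of "blinfun_inverse (X s)"]]
  by (simp add: blinfun_compose_algebra)

lemma evolution_deriv_right: "((\<lambda>s. T t s) has_vector_derivative - (T t s o\<^sub>L A s)) (at s)"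
  unfolding evolution_operator_def
  using has_vector_derivative_blinfun_compose[OF has_vector_derivative_const[of "X t"]
      inverse_deriv[of s]]
  by (simp add: blinfun_compose_algebra)

text \<open>\<open>T s u (y u)\<close> is constant in \<open>u\<close>, because the two terms
  \<open>T s u (A u (y u))\<close> of its derivative cancel. Derivatives within \<open>{s..}\<close>
  match \<open>solution_from\<close>.\<close>

lemma solution_eq_evolution:
  assumes y: "\<And>t. t \<ge> s \<Longrightarrow> (y has_vector_derivative A t (y t)) (at t within {s..})" and "t \<ge> s"
  shows "y t = T t s (y s)"
proof -
  define v where "v = (\<lambda>u. T s u (y u))"
  have "(v has_derivative (\<lambda>h. 0)) (at u within {s..})" if "u \<in> {s..}" for u
  proof -
    have "(v has_vector_derivative T s u (A u (y u)) + (- (T s u o\<^sub>L A u)) (y u)) (at u within {s..})"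
      unfolding v_def using that
      by (intro bounded_bilinear.has_vector_derivative[OF bounded_bilinear_blinfun_apply
            has_vector_derivative_at_within[OF evolution_deriv_right] y]) simp
    then show ?thesis
      by (simp add: has_vector_derivative_def blinfun.minus_left)
  qed
  then obtain c where "\<And>u. u \<in> {s..} \<Longrightarrow> v u = c"
    using has_derivative_zero_constant[OF convex_real_interval(1)] by blast
  then have "v t = v s"
    using \<open>t \<ge> s\<close> by simp
  then have "T s t (y t) = y s"
    by (simp add: v_def)
  then have "T t s (y s) = (T t s o\<^sub>L T s t) (y t)"
    by simp
  then show ?thesis
    by (simp add: evolution_compose)
qed

end

subsection \<open>Perturbation estimate and stability\<close>

text \<open>The restriction \<open>t - s \<le> h\<close> keeps every \<open>u\<close> between
  \<open>s\<close> and \<tau> within distance \<open>h\<close> of \<tau>, so \<open>E\<close> is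
  bounded by \<delta> on the whole interval of integration.\<close>

lemma perturbed_evolution_local_bound:
  fixes A B :: "real \<Rightarrow> 'a::banach \<Rightarrow>\<^sub>L 'a"
  assumes A: "bounded_operator_ode A M" and B: "bounded_operator_ode B M"
    and "K \<ge> 0"
    and T_le: "\<And>t s. t \<ge> s \<Longrightarrow> norm (evolution_operator A t s) \<le> K * exp (\<alpha> * (t - s))"
    and B_le: "\<And>t1 t2. \<bar>t2 - t1\<bar> \<le> h \<Longrightarrow> norm (oriented_integral t1 t2 B) \<le> \<delta>"
    and "s \<le> t" "t - s \<le> h"
  shows "norm (evolution_operator (\<lambda>t. A t + B t) t s)
    \<le> (1 + \<delta>) * K * exp ((\<alpha> + 3 * M * K * \<delta>) * (t - s))"
proof -
  interpret A: bounded_operator_ode A M by fact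
  interpret B: bounded_operator_ode B M by fact
  interpret AB: bounded_operator_ode "\<lambda>t. A t + B t" "M + M"
    by (intro bounded_operator_ode.intro continuous_on_add norm_triangle_le add_mono
        A.A_cont B.A_cont A.A_le B.A_le)
  define F where "F = (\<lambda>t. oriented_integral 0 t B)"
  have F': "(F has_vector_derivative B t) (at t)" for t
    unfolding F_def by (rule oriented_integral_has_vector_derivative[OF B.A_cont])
  have F_le: "norm (F v - F u) \<le> \<delta>" if "\<bar>v - u\<bar> \<le> h" for u v
    using B_le[OF that] oriented_integral_eq_diff[OF F'] by simp
  have "\<delta> \<ge> 0"
    using order.trans[OF norm_ge_zero F_le[of s s]] assms(6,7) by simp
  define k where "k = 3 * M * K * \<delta>"
  have "k \<ge> 0"
    using A.M_nonneg \<open>K \<ge> 0\<close> \<open>\<delta> \<ge> 0\<close> by (simp add: k_def)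
  \<comment> \<open>Dividing out \<open>exp (\<alpha> * (u - s))\<close> turns the kernel
    \<open>exp (\<alpha> * (\<tau> - u))\<close> into a factor independent of \<open>u\<close>,
    which leaves the constant \<open>k\<close> for Gronwall's inequality.\<close>
  define f where "f = (\<lambda>u. exp (- \<alpha> * (u - s)) * norm (AB.T u s))"
  have f_eq: "f u = norm (AB.T u s) / exp (\<alpha> * (u - s))" for u
    by (simp add: f_def exp_minus divide_inverse)
  have S_cont: "continuous_on I (\<lambda>u. norm (AB.T u s))" for I
    by (intro continuous_on_norm has_vector_derivative_UNIV_continuous_on[OF AB.evolution_deriv])
  have f_cont: "continuous_on I f" for I
    unfolding f_def by (intro continuous_intros S_cont)
  have "f t \<le> ((1 + \<delta>) * K) * exp (k * (t - s))"
  proof (rule gronwall[OF f_cont \<open>s \<le> t\<close> \<open>k \<ge> 0\<close>])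
    fix \<tau> assume \<tau>: "s \<le> \<tau>" "\<tau> \<le> t"
    define E where "E = (\<lambda>u. F u - F \<tau>)"
    define R where "R = (\<lambda>u. (A u o\<^sub>L E u) - (E u o\<^sub>L A u) - (E u o\<^sub>L B u))"
    define W where "W = (\<lambda>u. A.T \<tau> u o\<^sub>L ((id_blinfun - E u) o\<^sub>L AB.T u s))"
    \<comment> \<open>Since \<open>E' = B\<close>, the factor \<open>id_blinfun - E\<close> cancels the terms of \<open>W'\<close> that contain \<open>B\<close>
      but not \<open>E\<close>: this is an integration by parts in the variation of constants formula.\<close>
    have E': "((\<lambda>u. id_blinfun - E u) has_vector_derivative - B u) (at u)" for u
      unfolding E_def by (auto intro!: derivative_eq_intros F')
    have W': "(W has_vector_derivative A.T \<tau> u o\<^sub>L (R u o\<^sub>L AB.T u s)) (at u)" for u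
      unfolding W_def R_def
      using has_vector_derivative_blinfun_compose[OF A.evolution_deriv_right
          has_vector_derivative_blinfun_compose[OF E' AB.evolution_deriv]]
      by (simp add: blinfun_compose_algebra algebra_simps)
    have "norm (W \<tau> - W s) \<le> integral {s..\<tau>} (\<lambda>u. exp (\<alpha> * (\<tau> - s)) * (k * f u))"
    proof (rule norm_le_integral_of_derivative[OF \<tau>(1) W'])
      show "continuous_on {s..\<tau>} (\<lambda>u. exp (\<alpha> * (\<tau> - s)) * (k * f u))"
        by (intro continuous_intros f_cont)
      fix u assume u: "s \<le> u" "u \<le> \<tau>"
      then have E: "norm (E u) \<le> \<delta>"
        unfolding E_def using \<tau> assms(7) by (intro F_le) auto
      \<comment> \<open>Each of the three products in \<open>R\<close> has one factor bounded by
        \<open>M\<close> and one bounded by \<delta>; hence the 3 in \<beta>.\<close>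
      have "norm (R u) \<le> M * \<delta> + \<delta> * M + \<delta> * M"
        unfolding R_def
        by (intro norm_triangle_le_diff add_mono order.trans[OF norm_blinfun_compose]
            mult_mono E A.A_le B.A_le norm_ge_zero A.M_nonneg \<open>\<delta> \<ge> 0\<close>)
      then have R: "norm (R u) \<le> 3 * M * \<delta>"
        by simp
      have "norm (A.T \<tau> u o\<^sub>L (R u o\<^sub>L AB.T u s)) \<le> norm (A.T \<tau> u) * (norm (R u) * norm (AB.T u s))"
        by (intro order.trans[OF norm_blinfun_compose] mult_left_mono norm_blinfun_compose norm_ge_zero)
      also have "\<dots> \<le> (K * exp (\<alpha> * (\<tau> - u))) * ((3 * M * \<delta>) * norm (AB.T u s))"
        using \<open>K \<ge> 0\<close> u
        by (intro mult_mono mult_right_mono R T_le) auto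
      also have "\<dots> = exp (\<alpha> * (\<tau> - s)) * (k * f u)"
        by (simp add: f_def k_def algebra_simps flip: exp_add)
      finally show "norm (A.T \<tau> u o\<^sub>L (R u o\<^sub>L AB.T u s)) \<le> exp (\<alpha> * (\<tau> - s)) * (k * f u)" .
    qed
    then have "norm (W \<tau> - W s) \<le> exp (\<alpha> * (\<tau> - s)) * (k * integral {s..\<tau>} f)"
      by simp
    \<comment> \<open>At \<tau> only \<open>AB.T\<close> remains, since \<open>E \<tau> = 0\<close>.
      At \<open>s\<close> the product is \<open>A.T \<tau> s\<close> composed with
      \<open>id_blinfun - E s\<close>, the source of the factor \<open>1 + \<delta>\<close>.\<close>
    moreover have "W \<tau> = AB.T \<tau> s"
      by (simp add: W_def E_def)
    moreover have "norm (W s) \<le> (K * exp (\<alpha> * (\<tau> - s))) * (1 + \<delta>)"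
    proof -
      have "norm (id_blinfun - E s) \<le> 1 + \<delta>"
        using \<tau> assms(7) F_le[of s \<tau>]
        by (intro order.trans[OF norm_triangle_ineq4] add_mono norm_blinfun_id_le)
          (auto simp: E_def norm_minus_commute)
      then have "norm (A.T \<tau> s) * norm (id_blinfun - E s) \<le> (K * exp (\<alpha> * (\<tau> - s))) * (1 + \<delta>)"
        using T_le \<open>K \<ge> 0\<close> \<tau> by (intro mult_mono) auto
      then show ?thesis
        by (simp add: W_def order.trans[OF norm_blinfun_compose])
    qed
    ultimately have "norm (AB.T \<tau> s)
        \<le> exp (\<alpha> * (\<tau> - s)) * ((1 + \<delta>) * K + k * integral {s..\<tau>} f)"
      using norm_triangle_sub[of "AB.T \<tau> s" "W s"] by (simp add: algebra_simps)
    then show "f \<tau> \<le> (1 + \<delta>) * K + k * integral {s..\<tau>} f"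
      unfolding f_eq[of \<tau>] by (simp add: pos_divide_le_eq mult.commute)
  qed
  then have "norm (AB.T t s) \<le> exp (\<alpha> * (t - s)) * ((1 + \<delta>) * K * exp (k * (t - s)))"
    by (simp add: f_eq pos_divide_le_eq mult.commute)
  moreover have "exp ((\<alpha> + k) * (t - s)) = exp (\<alpha> * (t - s)) * exp (k * (t - s))"
    by (simp add: distrib_right exp_add)
  ultimately show ?thesis
    unfolding k_def[symmetric] by (simp add: mult_ac)
qed

text \<open>At most \<open>(t - s) / h + 1\<close> pieces of length \<open>h\<close> are needed. The
  quotient produces the rate \<open>ln D / h\<close>, the additional piece the prefactor
  \<open>D\<close>.\<close>

lemma (in bounded_operator_ode) evolution_bound_iterate:
  assumes local: "\<And>t s. s \<le> t \<Longrightarrow> t - s \<le> h \<Longrightarrow> norm (T t s) \<le> D * exp (\<gamma> * (t - s))"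
    and "h > 0" "D \<ge> 1" "s \<le> t"
  shows "norm (T t s) \<le> D * exp ((\<gamma> + ln D / h) * (t - s))"
proof -
  \<comment> \<open>\<open>Suc n\<close> counts the pieces; \<open>s\<close> varies because the
    induction splits off the first piece, from \<open>s\<close> to \<open>s + h\<close>.\<close>
  have iter: "norm (T t s) \<le> D ^ Suc n * exp (\<gamma> * (t - s))"
    if "s \<le> t" "t - s \<le> real (Suc n) * h" for n s
    using that
  proof (induction n arbitrary: s)
    case 0
    then show ?case using local by simp
  next
    case (Suc n)
    show ?case
    proof (cases "t - s \<le> h")
      case True
      have "D ^ 1 \<le> D ^ Suc (Suc n)"
        using \<open>D \<ge> 1\<close> by (intro power_increasing) auto
      then show ?thesis
        using order.trans[OF local[OF Suc.prems(1) True] mult_right_mono] by simp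
    next
      case False
      define r where "r = s + h"
      have "norm (T t s) \<le> norm (T t r) * norm (T r s)"
        using norm_blinfun_compose[of "T t r" "T r s"] by (simp add: evolution_compose)
      also have "\<dots> \<le> (D ^ Suc n * exp (\<gamma> * (t - r))) * (D * exp (\<gamma> * (r - s)))"
        using Suc.prems False \<open>h > 0\<close> \<open>D \<ge> 1\<close>
        by (intro mult_mono Suc.IH local) (auto simp: r_def algebra_simps)
      also have "\<dots> = D ^ Suc (Suc n) * exp (\<gamma> * (t - s))"
        by (simp add: algebra_simps flip: exp_add)
      finally show ?thesis .
    qed
  qed
  \<comment> \<open>The floor serves twice: \<open>Suc n\<close> pieces cover the interval, and
    \<open>n \<le> (t - s) / h\<close> bounds \<open>D ^ n\<close>, as
    \<open>ln D \<ge> 0\<close>.\<close>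
  define n where "n = nat \<lfloor>(t - s) / h\<rfloor>"
  have n: "real n \<le> (t - s) / h" "(t - s) / h \<le> real (Suc n)"
    using \<open>h > 0\<close> \<open>s \<le> t\<close> by (auto simp: n_def) linarith
  have "norm (T t s) \<le> D ^ Suc n * exp (\<gamma> * (t - s))"
    using n \<open>h > 0\<close> \<open>s \<le> t\<close> by (intro iter) (auto simp: field_simps)
  also have "D ^ n = exp (real n * ln D)"
    using \<open>D \<ge> 1\<close> by (simp add: exp_of_nat_mult)
  then have "D ^ Suc n \<le> D * exp ((t - s) / h * ln D)"
    using mult_right_mono[OF n(1), of "ln D"] \<open>D \<ge> 1\<close> by simp
  then have "D ^ Suc n * exp (\<gamma> * (t - s)) \<le> D * exp ((t - s) / h * ln D) * exp (\<gamma> * (t - s))"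
    by (intro mult_right_mono) auto
  also have "\<dots> = D * exp ((\<gamma> + ln D / h) * (t - s))"
    by (simp add: algebra_simps add_divide_distrib diff_divide_distrib flip: exp_add)
  finally show ?thesis .
qed

text \<open>Every solution from \<open>t0\<close> is \<open>T t t0 (y t0)\<close> and inherits the
  exponential bound.\<close>

lemma (in bounded_operator_ode) asymptotically_stable_of_evolution_bound:
  assumes T_le: "\<And>t s. s \<le> t \<Longrightarrow> norm (T t s) \<le> D * exp (\<beta> * (t - s))" and "D > 0" "\<beta> < 0"
  shows "asymptotically_stable (\<lambda>t. blinfun_apply (A t))"
  unfolding asymptotically_stable_def
proof (intro allI conjI impI)
  fix t0 :: real
  have y_le: "norm (y t) \<le> D * exp (\<beta> * (t - t0)) * norm (y t0)"
    if "solution_from (\<lambda>t. blinfun_apply (A t)) t0 y" "t \<ge> t0" for y t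
  proof -
    have "y t = T t t0 (y t0)"
      using that unfolding solution_from_def by (intro solution_eq_evolution) auto
    then have "norm (y t) \<le> norm (T t t0) * norm (y t0)"
      by (simp add: norm_blinfun)
    also have "\<dots> \<le> D * exp (\<beta> * (t - t0)) * norm (y t0)"
      using that by (intro mult_right_mono T_le) auto
    finally show ?thesis .
  qed
  show "\<exists>\<eta>>0. \<forall>y. solution_from (\<lambda>t. blinfun_apply (A t)) t0 y \<longrightarrow> norm (y t0) < \<eta> \<longrightarrow>
      (\<forall>t\<ge>t0. norm (y t) < \<epsilon>)" if "\<epsilon> > 0" for \<epsilon>
  \<comment> \<open>For \<open>t \<ge> t0\<close> the exponential is at most 1, so solutions grow by
    at most the factor \<open>D\<close>.\<close>
  proof (intro exI[of _ "\<epsilon> / D"] conjI allI impI)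
    show "0 < \<epsilon> / D" using that \<open>D > 0\<close> by simp
    fix y t assume y: "solution_from (\<lambda>t. blinfun_apply (A t)) t0 y" "norm (y t0) < \<epsilon> / D" "t0 \<le> t"
    have "norm (y t) \<le> D * exp (\<beta> * (t - t0)) * norm (y t0)"
      using y by (intro y_le) auto
    also have "\<dots> \<le> D * 1 * norm (y t0)"
      using \<open>D > 0\<close> \<open>\<beta> < 0\<close> y by (intro mult_right_mono mult_left_mono) (auto simp: mult_nonpos_nonneg)
    also have "\<dots> < \<epsilon>"
      using y(2) \<open>D > 0\<close> by (simp add: field_simps)
    finally show "norm (y t) < \<epsilon>" .
  qed
  show "\<exists>\<eta>>0. \<forall>y. solution_from (\<lambda>t. blinfun_apply (A t)) t0 y \<longrightarrow> norm (y t0) < \<eta> \<longrightarrow>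
      (y \<longlongrightarrow> 0) at_top"
  \<comment> \<open>The decay bound holds for all initial values; the radius 1 is arbitrary.\<close>
  proof (intro exI[of _ 1] conjI allI impI)
    fix y assume y: "solution_from (\<lambda>t. blinfun_apply (A t)) t0 y"
    have "((\<lambda>t. D * exp (\<beta> * (t - t0)) * norm (y t0)) \<longlongrightarrow> 0) at_top"
      using \<open>\<beta> < 0\<close> by real_asymp
    then show "(y \<longlongrightarrow> 0) at_top"
      by (rule Lim_null_comparison[rotated])
        (use y_le[OF y] in \<open>auto simp: eventually_at_top_linorder\<close>)
  qed simp
qed

theorem theorem1:
  fixes A B :: "real \<Rightarrow> ('a::banach \<Rightarrow>\<^sub>L 'a)"
    and M K \<alpha> \<beta> \<delta> h :: real
  assumes "continuous_on UNIV A" and "continuous_on UNIV B"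
    and "\<And>t. norm (A t) \<le> M" and "\<And>t. norm (B t) \<le> M"
    and "K \<ge> 1"
    and "\<And>t s. t \<ge> s \<Longrightarrow> norm (evolution_operator A t s) \<le> K * exp (\<alpha> * (t - s))"
    and "\<delta> > 0" and "h > 0"
    and "\<And>t1 t2. \<bar>t2 - t1\<bar> \<le> h \<Longrightarrow> norm (oriented_integral t1 t2 B) \<le> \<delta>"
    and "\<beta> = \<alpha> + 3 * M * K * \<delta> + ln ((1 + \<delta>) * K) / h"
  shows "(\<forall>t s. t \<ge> s \<longrightarrow>
            norm (evolution_operator (\<lambda>t. A t + B t) t s)
              \<le> (1 + \<delta>) * K * exp (\<beta> * (t - s)))
       \<and> (\<alpha> < 0 \<and> \<beta> < 0 \<longrightarrow>
            asymptotically_stable (\<lambda>t y. blinfun_apply (A t) y + blinfun_apply (B t) y))"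
proof -
  have A: "bounded_operator_ode A M" and B: "bounded_operator_ode B M"
    using assms(1-4) by (auto intro: bounded_operator_ode.intro)
  \<comment> \<open>The bound \<open>M + M\<close> provides the evolution operator of the sum;
    \<beta> comes from the separate bounds on \<open>A\<close> and \<open>B\<close>.\<close>
  interpret AB: bounded_operator_ode "\<lambda>t. A t + B t" "M + M"
    using assms(1-4)
    by (intro bounded_operator_ode.intro continuous_on_add norm_triangle_le add_mono)
  have D: "(1 + \<delta>) * K \<ge> 1"
    using mult_mono[of 1 "1 + \<delta>" 1 K] \<open>\<delta> > 0\<close> \<open>K \<ge> 1\<close> by simp
  have bound: "norm (AB.T t s) \<le> (1 + \<delta>) * K * exp (\<beta> * (t - s))" if "s \<le> t" for t s
    unfolding assms(10)
    using perturbed_evolution_local_bound[OF A B _ assms(6) assms(9)] \<open>K \<ge> 1\<close> that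
    by (intro AB.evolution_bound_iterate[OF _ \<open>h > 0\<close> D]) auto
  moreover have "(\<lambda>t y. A t y + B t y) = (\<lambda>t. blinfun_apply (A t + B t))"
    by (simp add: fun_eq_iff blinfun.add_left)
  then have "asymptotically_stable (\<lambda>t y. A t y + B t y)" if "\<beta> < 0"
    using AB.asymptotically_stable_of_evolution_bound[OF bound _ that] D by simp
  ultimately show ?thesis
    by blast
qed

end
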